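(* Let $X$ be an extremally disconnected regular Hausdorff space, $Y$ be a completely regular Hausdorff space, and $\varphi$ be an usco mapping from $X$ to the nonempty subsets of $Y$. Then for every dense subset $A\subset X$ and every continuous map $g:A\to Y$ with $g(x)\in\varphi(x)$ for all $x\in A$, there exists a continuous map $f:X\to Y$ such that $f(x)\in\varphi(x)$ for all $x\in X$ and $f(x)=g(x)$ for all $x\in A$.
   Context: A space $X$ is extremally disconnected if $\overline{U}$ is open for every open $U\subset X$. A mapping $\varphi$ assigning to each $x\in X$ a nonempty subset $\varphi(x)\subset Y$ is upper semi-continuous (u.s.c.) if $\{x\in X:\varphi(x)\cap F\neq\varnothing\}$ is closed in $X$ for every closed $F\subset Y$; it is usco if it is u.s.c. and every $\varphi(x)$, $x\in X$, is compact. The subset $A\subset X$ carries the subspace topology. *)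

theory Defs
  imports "HOL-Analysis.Analysis"
begin

definition extremally_disconnected_space :: "'a topology \<Rightarrow> bool"
  where "extremally_disconnected_space X \<longleftrightarrow>
    (\<forall>U. openin X U \<longrightarrow> openin X (X closure_of U))"

text \<open>As with \<open>continuous_map\<close>, the values of a mapping outside \<open>topspace X\<close> are irrelevant.\<close>

definition set_valued_map :: "'a topology \<Rightarrow> 'b topology \<Rightarrow> ('a \<Rightarrow> 'b set) \<Rightarrow> bool"
  where "set_valued_map X Y \<phi> \<longleftrightarrow>
    (\<forall>x \<in> topspace X. \<phi> x \<noteq> {} \<and> \<phi> x \<subseteq> topspace Y)"

definition usc_map :: "'a topology \<Rightarrow> 'b topology \<Rightarrow> ('a \<Rightarrow> 'b set) \<Rightarrow> bool"
  where "usc_map X Y \<phi> \<longleftrightarrow> set_valued_map X Y \<phi> \<and>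
    (\<forall>F. closedin Y F \<longrightarrow> closedin X {x \<in> topspace X. \<phi> x \<inter> F \<noteq> {}})"

definition usco_map :: "'a topology \<Rightarrow> 'b topology \<Rightarrow> ('a \<Rightarrow> 'b set) \<Rightarrow> bool"
  where "usco_map X Y \<phi> \<longleftrightarrow> usc_map X Y \<phi> \<and> (\<forall>x \<in> topspace X. compactin Y (\<phi> x))"

end

theory Submission
  imports Defs
begin

text \<open>
  The value of the extension at \<open>x\<close> is the cluster point, inside \<open>\<phi> x\<close>, of the values of \<open>g\<close> near \<open>x\<close>.
  Upper semicontinuity and compactness of \<open>\<phi> x\<close> yield such a point. It is unique because, in an
  extremally disconnected space, disjoint open sets have disjoint closures, so that two points
  separated in \<open>Y\<close> cannot both be approached by values of \<open>g\<close> near \<open>x\<close>. Uniqueness,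
  compactness and upper semicontinuity give continuity.
\<close>

text \<open>The finite intersection property leaves finitely many members whose intersection misses
  \<open>S\<close>, and directedness puts a single member below all of them. Nonemptiness of
  \<open>\<C>\<close> covers the case of an empty finite subfamily.\<close>

lemma compactin_directed_Int_empty:
  assumes "compactin Y S" and "\<C> \<noteq> {}" and closed: "\<And>C. C \<in> \<C> \<Longrightarrow> closedin Y C"
    and directed: "\<And>C D. C \<in> \<C> \<Longrightarrow> D \<in> \<C> \<Longrightarrow> \<exists>E\<in>\<C>. E \<subseteq> C \<inter> D"
    and "S \<inter> \<Inter>\<C> = {}"
  shows "\<exists>C\<in>\<C>. S \<inter> C = {}"
proof -
  obtain \<F> where \<F>: "finite \<F>" "\<F> \<subseteq> \<C>" "S \<inter> \<Inter>\<F> = {}"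
    using assms(1,5) closed unfolding compactin_fip by meson
  have "\<exists>C\<in>\<C>. C \<subseteq> \<Inter>\<F>"
    using \<F>(1,2)
  proof (induction \<F> rule: finite_induct)
    case empty
    then show ?case using \<open>\<C> \<noteq> {}\<close> by auto
  next
    case (insert D \<F>)
    then obtain C where "C \<in> \<C>" "C \<subseteq> \<Inter>\<F>" "D \<in> \<C>" by auto
    with directed[of C D] show ?case by auto
  qed
  with \<F>(3) show ?thesis by blast
qed

text \<open>An open set disjoint from another set also misses its closure. This is applied twice:
  first to \<open>V\<close>, then to the closure of \<open>U\<close>, which is itself open
  here.\<close>

lemma extremally_disconnected_disjoint_closures:
  assumes "extremally_disconnected_space X" and "openin X U" and "openin X V" and "U \<inter> V = {}"
  shows "X closure_of U \<inter> X closure_of V = {}"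
proof -
  have "X closure_of U \<inter> V = {}"
    using assms openin_Int_closure_of_eq_empty[of X V U] by (simp add: Int_commute)
  then show ?thesis
    using assms openin_Int_closure_of_eq_empty[of X "X closure_of U" V]
    by (simp add: extremally_disconnected_space_def)
qed

text \<open>For a point of \<open>X\<close> this is the cluster set at \<open>x\<close> of
  \<open>g\<close> along \<open>A\<close>: the cluster points of the filter base of images of
  \<open>U \<inter> A\<close>, with \<open>U\<close> running over the open neighbourhoods of
  \<open>x\<close>.\<close>

definition cluster_values ::
    "'a topology \<Rightarrow> 'b topology \<Rightarrow> 'a set \<Rightarrow> ('a \<Rightarrow> 'b) \<Rightarrow> 'a \<Rightarrow> 'b set"
  where "cluster_values X Y A g x = (\<Inter>U\<in>{U. openin X U \<and> x \<in> U}. Y closure_of (g ` (U \<inter> A)))"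

text \<open>Neighbourhoods of \<open>x\<close> are closed under intersection, so the closures form a
  directed family. The compact set \<open>S\<close> is left general because it is taken to be both
  \<open>\<phi> x\<close> and \<open>\<phi> x\<close> minus an open set.\<close>

lemma compactin_disjoint_cluster_values:
  assumes "compactin Y S" and "x \<in> topspace X" and "S \<inter> cluster_values X Y A g x = {}"
  obtains U where "openin X U" "x \<in> U" "S \<inter> Y closure_of (g ` (U \<inter> A)) = {}"
proof -
  let ?\<C> = "(\<lambda>U. Y closure_of (g ` (U \<inter> A))) ` {U. openin X U \<and> x \<in> U}"
  have "\<exists>C\<in>?\<C>. S \<inter> C = {}"
  proof (rule compactin_directed_Int_empty)
    show "?\<C> \<noteq> {}" using assms(2) by blast
    show "S \<inter> \<Inter>?\<C> = {}" using assms(3) by (simp add: cluster_values_def)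
  next
    fix C D assume "C \<in> ?\<C>" "D \<in> ?\<C>"
    then obtain U V where UV: "openin X U" "x \<in> U" "openin X V" "x \<in> V"
      and C: "C = Y closure_of (g ` (U \<inter> A))" and D: "D = Y closure_of (g ` (V \<inter> A))"
      by blast
    have "Y closure_of (g ` (U \<inter> V \<inter> A)) \<subseteq> C \<inter> D"
      unfolding C D by (intro Int_greatest closure_of_mono) auto
    moreover have "openin X (U \<inter> V)" using UV by auto
    ultimately show "\<exists>E\<in>?\<C>. E \<subseteq> C \<inter> D" using UV by blast
  qed (use assms(1) in auto)
  then show thesis using that by blast
qed

lemma usc_map_avoids_closed_nhd:
  assumes "usc_map X Y \<phi>" and "closedin Y F" and "x \<in> topspace X" and "\<phi> x \<inter> F = {}"
  obtains U where "openin X U" "x \<in> U" "\<And>z. z \<in> U \<Longrightarrow> \<phi> z \<inter> F = {}"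
proof -
  let ?U = "topspace X - {z \<in> topspace X. \<phi> z \<inter> F \<noteq> {}}"
  have "openin X ?U"
    using assms(1,2) by (auto simp: usc_map_def)
  with assms(3,4) that[of ?U] show thesis by blast
qed

lemma usco_map_cluster_value_exists:
  assumes usco: "usco_map X Y \<phi>"
    and dense: "X closure_of A = topspace X"
    and g: "\<And>x. x \<in> A \<inter> topspace X \<Longrightarrow> g x \<in> \<phi> x"
    and x: "x \<in> topspace X"
  shows "\<phi> x \<inter> cluster_values X Y A g x \<noteq> {}"
proof
  have usc: "usc_map X Y \<phi>" and "compactin Y (\<phi> x)"
    using usco x by (auto simp: usco_map_def)
  assume "\<phi> x \<inter> cluster_values X Y A g x = {}"
  then obtain U where U: "openin X U" "x \<in> U" "\<phi> x \<inter> Y closure_of (g ` (U \<inter> A)) = {}"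
    using compactin_disjoint_cluster_values[OF \<open>compactin Y (\<phi> x)\<close> x] by metis
  then obtain V where V: "openin X V" "x \<in> V"
    and disj: "\<And>z. z \<in> V \<Longrightarrow> \<phi> z \<inter> Y closure_of (g ` (U \<inter> A)) = {}"
    using usc_map_avoids_closed_nhd[OF usc closedin_closure_of x] by metis
  have "openin X (U \<inter> V)" using U V by auto
  moreover have "x \<in> X closure_of A" and "x \<in> U \<inter> V" using dense x U V by auto
  ultimately obtain a where a: "a \<in> A" "a \<in> U" "a \<in> V"
    unfolding in_closure_of by blast
  then have "a \<in> topspace X" using openin_subset[OF U(1)] by blast
  then have "g a \<in> \<phi> a" using a g by auto
  moreover have "g a \<in> topspace Y"
    using usc \<open>g a \<in> \<phi> a\<close> \<open>a \<in> topspace X\<close> by (auto simp: usc_map_def set_valued_map_def)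
  then have "g a \<in> Y closure_of (g ` (U \<inter> A))"
    using a by (auto simp: in_closure_of)
  ultimately show False using disj a(3) by blast
qed

lemma cluster_values_unique:
  assumes ED: "extremally_disconnected_space X" and "Hausdorff_space Y"
    and dense: "X closure_of A = topspace X"
    and g: "continuous_map (subtopology X A) Y g"
    and x: "x \<in> topspace X"
    and y: "y \<in> cluster_values X Y A g x" and z: "z \<in> cluster_values X Y A g x"
  shows "y = z"
proof (rule ccontr)
  assume "y \<noteq> z"
  \<comment> \<open>The whole space is one of the neighbourhoods of \<open>x\<close>, so cluster
    values lie in a closure taken in \<open>Y\<close>.\<close>
  have "y \<in> topspace Y" "z \<in> topspace Y"
    using x y z unfolding cluster_values_def
    by (metis (mono_tags, lifting) INT_E closure_of_subset_topspace mem_Collect_eq openin_topspace subsetD)+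
  then obtain V W where VW: "openin Y V" "openin Y W" "y \<in> V" "z \<in> W" "V \<inter> W = {}"
    using \<open>Hausdorff_space Y\<close> \<open>y \<noteq> z\<close> unfolding Hausdorff_space_def disjnt_def by meson
  have pre: "\<exists>P. openin X P \<and> {a \<in> topspace (subtopology X A). g a \<in> Q} = P \<inter> A" if "openin Y Q" for Q
    using openin_continuous_map_preimage[OF g that] by (simp add: openin_subtopology)
  obtain P where P: "openin X P" "{a \<in> topspace (subtopology X A). g a \<in> V} = P \<inter> A"
    using pre[OF VW(1)] by blast
  obtain Q where Q: "openin X Q" "{a \<in> topspace (subtopology X A). g a \<in> W} = Q \<inter> A"
    using pre[OF VW(2)] by blast
  have "P \<inter> Q \<inter> A = {}" using P Q VW(5) by blast
  \<comment> \<open>An open set that misses the dense set \<open>A\<close> is empty.\<close>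
  then have "P \<inter> Q = {}"
    using openin_Int_closure_of_eq_empty[of X "P \<inter> Q" A] P(1) Q(1) dense openin_subset[OF P(1)]
    by auto
  then have disj: "X closure_of P \<inter> X closure_of Q = {}"
    by (rule extremally_disconnected_disjoint_closures[OF ED P(1) Q(1)])
  \<comment> \<open>If \<open>x\<close> were outside the closure of \<open>P'\<close>, the
    complement of that closure would be a neighbourhood of \<open>x\<close> on whose points of
    \<open>A\<close> the map \<open>g\<close> never takes a value in \<open>V'\<close>, although
    \<open>v\<close> is a cluster value inside \<open>V'\<close>.\<close>
  have near: "x \<in> X closure_of P'"
    if P': "openin X P'" "{a \<in> topspace (subtopology X A). g a \<in> V'} = P' \<inter> A"
      and V': "openin Y V'" "v \<in> V'" "v \<in> cluster_values X Y A g x" for P' V' v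
  proof (rule ccontr)
    let ?U = "topspace X - X closure_of P'"
    assume "x \<notin> X closure_of P'"
    then have "openin X ?U" "x \<in> ?U" using x by auto
    then have "v \<in> Y closure_of (g ` (?U \<inter> A))"
      using V'(3) unfolding cluster_values_def by blast
    then obtain a where "a \<in> ?U" "a \<in> A" "g a \<in> V'"
      using V'(1,2) unfolding in_closure_of by blast
    then show False
      using P' closure_of_subset[OF openin_subset[OF P'(1)]] by auto
  qed
  show False
    using near[OF P VW(1,3) y] near[OF Q VW(2,4) z] disj by blast
qed

lemma continuous_map_cluster_selection:
  assumes usco: "usco_map X Y \<phi>"
    and f: "\<And>x. x \<in> topspace X \<Longrightarrow> f x \<in> \<phi> x \<inter> cluster_values X Y A g x"
    and unique: "\<And>x y. x \<in> topspace X \<Longrightarrow> y \<in> \<phi> x \<inter> cluster_values X Y A g x \<Longrightarrow> y = f x"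
  shows "continuous_map X Y f"
proof -
  have usc: "usc_map X Y \<phi>" and compact: "\<And>x. x \<in> topspace X \<Longrightarrow> compactin Y (\<phi> x)"
    using usco by (auto simp: usco_map_def)
  have sub: "\<phi> x \<subseteq> topspace Y" if "x \<in> topspace X" for x
    using usc that by (auto simp: usc_map_def set_valued_map_def)
  have nhd: "\<exists>U. openin X U \<and> x \<in> U \<and> (\<forall>z\<in>U. f z \<in> V)"
    if x: "x \<in> topspace X" and V: "openin Y V" "f x \<in> V" for x V
  proof -
    have "closedin Y (topspace Y - V)" using V by auto
    then have "compactin Y ((topspace Y - V) \<inter> \<phi> x)"
      by (rule closed_Int_compactin) (rule compact[OF x])
    moreover have "(topspace Y - V) \<inter> \<phi> x \<inter> cluster_values X Y A g x = {}"
      using unique[OF x] V(2) by blast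
    ultimately obtain U where U: "openin X U" "x \<in> U"
      and disj: "(topspace Y - V) \<inter> \<phi> x \<inter> Y closure_of (g ` (U \<inter> A)) = {}"
      using compactin_disjoint_cluster_values x by metis
    \<comment> \<open>Closed and disjoint from \<open>\<phi> x\<close> by the choice of
      \<open>U\<close>, so upper semicontinuity keeps \<open>\<phi> z\<close> away from it for
      \<open>z\<close> near \<open>x\<close>.\<close>
    let ?F = "Y closure_of (g ` (U \<inter> A)) - V"
    have "closedin Y ?F" using V(1) by (simp add: closedin_diff)
    moreover have "\<phi> x \<inter> ?F = {}" using disj sub[OF x] by blast
    ultimately obtain W where W: "openin X W" "x \<in> W" "\<And>z. z \<in> W \<Longrightarrow> \<phi> z \<inter> ?F = {}"
      using usc_map_avoids_closed_nhd[OF usc _ x] by metis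
    \<comment> \<open>\<open>U\<close> is a neighbourhood of \<open>z\<close> as well, so the
      cluster value \<open>f z\<close> lies in the same closure; since \<open>\<phi> z\<close>
      misses \<open>?F\<close>, it can only lie in \<open>V\<close>.\<close>
    have "f z \<in> V" if z: "z \<in> U \<inter> W" for z
    proof -
      have "f z \<in> \<phi> z" "f z \<in> cluster_values X Y A g z"
        using f[of z] z openin_subset[OF U(1)] by auto
      moreover from this have "f z \<in> Y closure_of (g ` (U \<inter> A))"
        using U(1) z unfolding cluster_values_def by blast
      ultimately show ?thesis using W(3)[of z] z by blast
    qed
    moreover have "openin X (U \<inter> W)" using U W by auto
    ultimately show ?thesis using U W by blast
  qed
  show ?thesis
    unfolding continuous_map_eq_topcontinuous_at topcontinuous_at_def
    using nhd f sub by blast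
qed

theorem proposition3p2:
  fixes X :: "'a topology" and Y :: "'b topology" and \<phi> :: "'a \<Rightarrow> 'b set"
  assumes "extremally_disconnected_space X" and "regular_space X" and "Hausdorff_space X"
    and "completely_regular_space Y" and "Hausdorff_space Y"
    and "usco_map X Y \<phi>"
  shows "\<forall>A g. A \<subseteq> topspace X \<and> X closure_of A = topspace X \<and>
      continuous_map (subtopology X A) Y g \<and> (\<forall>x \<in> A. g x \<in> \<phi> x) \<longrightarrow>
      (\<exists>f. continuous_map X Y f \<and> (\<forall>x \<in> topspace X. f x \<in> \<phi> x) \<and> (\<forall>x \<in> A. f x = g x))"
proof (intro allI impI, elim conjE)
  fix A g
  assume A: "A \<subseteq> topspace X" and dense: "X closure_of A = topspace X"
    and g: "continuous_map (subtopology X A) Y g" and g\<phi>: "\<forall>x\<in>A. g x \<in> \<phi> x"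
  have "\<forall>x\<in>topspace X. \<exists>y. y \<in> \<phi> x \<inter> cluster_values X Y A g x"
    using usco_map_cluster_value_exists[OF assms(6) dense, of g] g\<phi> by blast
  then obtain f where f: "\<And>x. x \<in> topspace X \<Longrightarrow> f x \<in> \<phi> x \<inter> cluster_values X Y A g x"
    by metis
  have unique: "y = f x" if "x \<in> topspace X" "y \<in> \<phi> x \<inter> cluster_values X Y A g x" for x y
    using cluster_values_unique[OF assms(1,5) dense g] f that by blast
  have "f x = g x" if x: "x \<in> A" for x
  proof -
    have "g x \<in> topspace Y"
      using g x A by (auto simp: continuous_map_def)
    then have "g x \<in> cluster_values X Y A g x"
      using x by (auto simp: cluster_values_def in_closure_of)
    then show ?thesis using unique[of x "g x"] x A g\<phi> by auto
  qed
  moreover have "continuous_map X Y f"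
    using assms(6) f unique by (rule continuous_map_cluster_selection)
  ultimately show "\<exists>f. continuous_map X Y f \<and> (\<forall>x \<in> topspace X. f x \<in> \<phi> x) \<and> (\<forall>x \<in> A. f x = g x)"
    using f by blast
qed

end
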